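(* Let $m \ge 2$ be an integer, $H \in (m-1,m)$ and $T \in (0,\infty)$, and let $B_{H,m}$ be an $m$-th order fractional Brownian motion with Hurst parameter $H$. Then for every $\alpha < 1$, almost surely, $$\lim_{n \to \infty}2^{\alpha n} \sum_{k = 1}^{2^n}\left(B_{H,m}\Big(\frac{kT}{2^n}\Big) - B_{H,m}\Big(\frac{(k-1)T}{2^n}\Big)\right)^2 = 0 .$$ Moreover, if $m \ge 3$, then for every $\alpha > 1$, almost surely, $$\lim_{n \to \infty}2^{\alpha n} \sum_{k = 1}^{2^n}\left(B_{H,m}\Big(\frac{kT}{2^n}\Big) - B_{H,m}\Big(\frac{(k-1)T}{2^n}\Big)\right)^2 = \infty .$$ In particular, for $m \ge 3$ the critical exponent of the weighted quadratic variation of $B_{H,m}$ is $\gamma = 1$.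
   Context: For an integer $m\ge 1$ and $H\in(m-1,m)$, an $m$-th order fractional Brownian motion $B_{H,m}=\{B_{H,m}(t),t\in[0,\infty)\}$ is a centered Gaussian process with covariance function $$G_{H,m}(s,t) = (-1)^m\frac{C_{H}^m}{2}\left(|t-s|^{2H} - \sum_{j = 0}^{m-1}(-1)^j\binom{2H}{j}\left(\Big(\frac{t}{s}\Big)^j s^{2H} + \Big(\frac{s}{t}\Big)^j t^{2H}\right)\right),$$ where $C_H^{m} = \big(\Gamma(2H+1)|\sin(\pi H)|\big)^{-1}$ (the superscript $m$ is an index, not a power), $\binom{2H}{j}$ is the generalized binomial coefficient, and $(t/s)^j s^{2H}$ is read as $t^j s^{2H-j}$ (so that the formula makes sense also when $s=0$ or $t=0$, with $0^0=1$). For a real-valued process $X=\{X(t),t\in[0,\infty)\}$, a number $\gamma\in\mathbb{R}$ is called the critical exponent of the weighted quadratic variation of $X$ if, almost surely, $\lim_{n\to\infty}2^{\alpha n}\sum_{k=1}^{2^n}\big(X(\frac{k}{2^n})-X(\frac{k-1}{2^n})\big)^2$ equals $0$ for $\alpha<\gamma$ and equals $\infty$ for $\alpha>\gamma$. *)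

theory Defs
  imports "HOL-Probability.Probability"
begin

(* Point masses count as Gaussian (variance zero), as needed for finite-dimensional
   distributions with singular covariance matrix, e.g. at time 0. *)
definition gaussian_rv :: "'a measure \<Rightarrow> ('a \<Rightarrow> real) \<Rightarrow> bool" where
  "gaussian_rv M X \<longleftrightarrow>
     X \<in> borel_measurable M \<and>
     (\<exists>\<mu> \<sigma>. 0 \<le> \<sigma> \<and>
        (if \<sigma> = 0 then (AE \<omega> in M. X \<omega> = \<mu>)
         else distributed M lborel X (\<lambda>x. ennreal (normal_density \<mu> \<sigma> x))))"

(* Processes are indexed by [0, \<infinity>); values at negative times are irrelevant.
   Joint Gaussianity of (X t)_{t \<in> J} is Gaussianity of all linear combinations. *)
definition gaussian_process :: "'a measure \<Rightarrow> (real \<Rightarrow> 'a \<Rightarrow> real) \<Rightarrow> bool" where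
  "gaussian_process M X \<longleftrightarrow>
     (\<forall>t\<ge>0. X t \<in> borel_measurable M) \<and>
     (\<forall>J c. finite J \<longrightarrow> J \<subseteq> {0..} \<longrightarrow> gaussian_rv M (\<lambda>\<omega>. \<Sum>t\<in>J. c t * X t \<omega>))"

definition covariance :: "'a measure \<Rightarrow> ('a \<Rightarrow> real) \<Rightarrow> ('a \<Rightarrow> real) \<Rightarrow> real" where
  "covariance M X Y =
     (\<integral>\<omega>. (X \<omega> - (\<integral>\<omega>'. X \<omega>' \<partial>M)) * (Y \<omega> - (\<integral>\<omega>'. Y \<omega>' \<partial>M)) \<partial>M)"

definition fbm_const :: "real \<Rightarrow> real" where
  "fbm_const H = inverse (Gamma (2 * H + 1) * \<bar>sin (pi * H)\<bar>)"

(* (t/s)^j s^(2H) is written as t^j s^(2H-j), with 0^0 = 1 for the natural power t^j;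
   for j < m and m - 1 < H the exponent 2H - j is positive, so 0 powr (2H - j) = 0
   is the intended value. *)
definition fbm_cov :: "real \<Rightarrow> nat \<Rightarrow> real \<Rightarrow> real \<Rightarrow> real" where
  "fbm_cov H m s t =
     (- 1) ^ m * (fbm_const H / 2) *
     (\<bar>t - s\<bar> powr (2 * H) -
      (\<Sum>j<m. (- 1) ^ j * ((2 * H) gchoose j) *
         (t ^ j * s powr (2 * H - real j) + s ^ j * t powr (2 * H - real j))))"

definition higher_order_fbm ::
    "'a measure \<Rightarrow> real \<Rightarrow> nat \<Rightarrow> (real \<Rightarrow> 'a \<Rightarrow> real) \<Rightarrow> bool" where
  "higher_order_fbm M H m B \<longleftrightarrow>
     gaussian_process M B \<and>
     (\<forall>t\<ge>0. (\<integral>\<omega>. B t \<omega> \<partial>M) = 0) \<and>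
     (\<forall>s\<ge>0. \<forall>t\<ge>0. covariance M (B s) (B t) = fbm_cov H m s t)"

definition weighted_qv :: "real \<Rightarrow> real \<Rightarrow> (real \<Rightarrow> real) \<Rightarrow> nat \<Rightarrow> real" where
  "weighted_qv \<alpha> T x n =
     2 powr (\<alpha> * real n) *
     (\<Sum>k = 1..2 ^ n. (x (real k * T / 2 ^ n) - x ((real k - 1) * T / 2 ^ n))\<^sup>2)"

definition critical_exponent :: "'a measure \<Rightarrow> (real \<Rightarrow> 'a \<Rightarrow> real) \<Rightarrow> real \<Rightarrow> bool" where
  "critical_exponent M X \<gamma> \<longleftrightarrow>
     (AE \<omega> in M.
        (\<forall>\<alpha><\<gamma>. weighted_qv \<alpha> 1 (\<lambda>t. X t \<omega>) \<longlonglongrightarrow> 0) \<and>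
        (\<forall>\<alpha>>\<gamma>. filterlim (weighted_qv \<alpha> 1 (\<lambda>t. X t \<omega>)) at_top sequentially))"

end

theory Submission
  imports Defs
begin

text \<open>For \<open>H > 1\<close> the variance of \<open>B t - B s\<close> is at most \<open>K * (t - s)\<^sup>2\<close> on \<open>[0, T]\<close>, so the
  weighted quadratic variation has expectation of order \<open>2 powr ((\<alpha> - 1) * n)\<close>. For \<open>\<alpha> < 1\<close> these
  expectations are summable, and the variations tend to zero almost surely.
  Conversely, Cauchy--Schwarz bounds the sum of the squared increments from below by
  \<open>(B T - B 0)\<^sup>2 / 2 ^ n\<close>. As \<open>B T - B 0\<close> is Gaussian with positive variance, it is almost surely
  nonzero, which forces divergence simultaneously for all \<open>\<alpha> > 1\<close>.\<close>

section \<open>Gaussian variables and almost sure convergence\<close>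

text \<open>Bochner integrals default to 0 on nonintegrable functions, so the covariance identities
  alone give no integrability. It is drawn from Gaussianity here, so that integrals may later be
  split linearly.\<close>

lemma gaussian_rv_square_integrable:
  assumes "prob_space M" "gaussian_rv M X"
  shows "integrable M (\<lambda>\<omega>. (X \<omega>)\<^sup>2)"
proof -
  interpret prob_space M by fact
  from assms(2) obtain \<mu> \<sigma> where X [measurable]: "X \<in> borel_measurable M" and "0 \<le> \<sigma>"
    and *: "if \<sigma> = 0 then (AE \<omega> in M. X \<omega> = \<mu>)
         else distributed M lborel X (\<lambda>x. ennreal (normal_density \<mu> \<sigma> x))"
    unfolding gaussian_rv_def by blast
  show ?thesis
  proof (cases "\<sigma> = 0")
    case True
    with * have "AE \<omega> in M. (X \<omega>)\<^sup>2 = \<mu>\<^sup>2" by auto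
    then show ?thesis
      by (subst integrable_cong_AE[where g = "\<lambda>_. \<mu>\<^sup>2"]) auto
  next
    case False
    with \<open>0 \<le> \<sigma>\<close> have \<sigma>: "0 < \<sigma>" by simp
    from False * have D: "distributed M lborel X (\<lambda>x. ennreal (normal_density \<mu> \<sigma> x))" by simp
    \<comment> \<open>The available moments are central, so x^2 is expanded around the mean as (x -
      \<mu>)^2 + 2 \<mu> (x - \<mu>) + \<mu>^2.\<close>
    have "integrable lborel (\<lambda>x. normal_density \<mu> \<sigma> x * (x - \<mu>)^2)"
      using integrable_normal_moment[OF \<sigma>] by simp
    moreover have "integrable lborel (\<lambda>x. normal_density \<mu> \<sigma> x * (x - \<mu>)^1)"
      using integrable_normal_moment[OF \<sigma>] by blast
    moreover have "integrable lborel (normal_density \<mu> \<sigma>)"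
      using integrable_normal_density[OF \<sigma>] .
    ultimately have "integrable lborel (\<lambda>x. normal_density \<mu> \<sigma> x * (x - \<mu>)^2
        + 2 * \<mu> * (normal_density \<mu> \<sigma> x * (x - \<mu>)^1) + \<mu>\<^sup>2 * normal_density \<mu> \<sigma> x)"
      by (intro Bochner_Integration.integrable_add integrable_mult_right)
    then have "integrable lborel (\<lambda>x. normal_density \<mu> \<sigma> x * x\<^sup>2)"
      by (rule Bochner_Integration.integrable_cong[THEN iffD1, rotated 2])
        (auto simp: power2_eq_square algebra_simps)
    then show ?thesis
      by (subst distributed_integrable[OF D, symmetric]) auto
  qed
qed

text \<open>A law with a density does not charge {0}. A point mass at \<mu> has second moment
  \<mu>^2, so a nonzero second moment rules out the mass at 0.\<close>

lemma gaussian_rv_AE_nonzero: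
  assumes "prob_space M" "gaussian_rv M X" "(\<integral>\<omega>. (X \<omega>)\<^sup>2 \<partial>M) \<noteq> 0"
  shows "AE \<omega> in M. X \<omega> \<noteq> 0"
proof -
  interpret prob_space M by fact
  from assms(2) obtain \<mu> \<sigma> where X [measurable]: "X \<in> borel_measurable M" and "0 \<le> \<sigma>"
    and *: "if \<sigma> = 0 then (AE \<omega> in M. X \<omega> = \<mu>)
         else distributed M lborel X (\<lambda>x. ennreal (normal_density \<mu> \<sigma> x))"
    unfolding gaussian_rv_def by blast
  show ?thesis
  proof (cases "\<sigma> = 0")
    case True
    with * have AE: "AE \<omega> in M. X \<omega> = \<mu>" by auto
    then have "(\<integral>\<omega>. (X \<omega>)\<^sup>2 \<partial>M) = (\<integral>\<omega>. \<mu>\<^sup>2 \<partial>M)"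
      by (intro integral_cong_AE) auto
    with assms(3) have "\<mu> \<noteq> 0" by (auto simp: prob_space)
    with AE show ?thesis by auto
  next
    case False
    with * have D: "distributed M lborel X (\<lambda>x. ennreal (normal_density \<mu> \<sigma> x))" by simp
    have "AE x in lborel. x \<noteq> (0::real)"
      by (rule AE_lborel_singleton)
    then have "AE x in lborel. 0 < ennreal (normal_density \<mu> \<sigma> x) \<longrightarrow> x \<noteq> 0"
      by auto
    then show ?thesis
      using distributed_AE2[OF D, of "\<lambda>x. x \<noteq> 0"] by simp
  qed
qed

text \<open>By monotone convergence the random series has finite expectation, so it converges almost
  surely and its terms vanish in the limit.\<close>

lemma AE_tendsto_0_if_summable_expectation:
  fixes Y :: "nat \<Rightarrow> 'a \<Rightarrow> real"
  assumes int: "\<And>n. integrable M (Y n)" and nonneg: "\<And>n \<omega>. 0 \<le> Y n \<omega>"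
    and sum: "summable (\<lambda>n. \<integral>\<omega>. Y n \<omega> \<partial>M)"
  shows "AE \<omega> in M. (\<lambda>n. Y n \<omega>) \<longlonglongrightarrow> 0"
proof -
  have [measurable]: "Y n \<in> borel_measurable M" for n
    using int by auto
  have "(\<integral>\<^sup>+\<omega>. (\<Sum>n. ennreal (Y n \<omega>)) \<partial>M) = (\<Sum>n. \<integral>\<^sup>+\<omega>. ennreal (Y n \<omega>) \<partial>M)"
    by (rule nn_integral_suminf) simp
  also have "\<dots> = (\<Sum>n. ennreal (\<integral>\<omega>. Y n \<omega> \<partial>M))"
    by (simp add: nn_integral_eq_integral int nonneg)
  also have "\<dots> \<noteq> \<infinity>"
    using sum by (simp add: suminf_ennreal2 integral_nonneg nonneg)
  finally have "AE \<omega> in M. (\<Sum>n. ennreal (Y n \<omega>)) \<noteq> \<infinity>"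
    by (intro nn_integral_noteq_infinite) auto
  then show ?thesis
    by eventually_elim
      (auto intro!: summable_LIMSEQ_zero summable_suminf_not_top simp: nonneg)
qed

section \<open>Deterministic estimates for the covariance function\<close>

lemma powr_lipschitz:
  fixes p T x y :: real
  assumes "1 \<le> p" "0 \<le> x" "x \<le> T" "0 \<le> y" "y \<le> T"
  shows "\<bar>x powr p - y powr p\<bar> \<le> p * T powr (p - 1) * \<bar>x - y\<bar>"
proof -
  have *: "b powr p - a powr p \<le> p * T powr (p - 1) * (b - a)"
    if ab: "0 \<le> a" "a < b" "b \<le> T" for a b :: real
  proof -
    have cont: "continuous_on {a..b} (\<lambda>x. x powr p)"
      using assms(1) ab by (intro continuous_on_powr' continuous_intros) auto
    \<comment> \<open>Differentiability is claimed only to the right of \<open>a\<close>, which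
      allows \<open>a = 0\<close>; the mean value theorem needs no more.\<close>
    have der: "((\<lambda>x. x powr p) has_real_derivative p * x powr (p - 1)) (at x)"
      if "a < x" for x
      using ab that by (intro has_real_derivative_powr) auto
    obtain z where z: "a < z" "z < b" "b powr p - a powr p = (b - a) * (p * z powr (p - 1))"
    proof -
      have "\<exists>l z. a < z \<and> z < b \<and> DERIV (\<lambda>x. x powr p) z :> l
          \<and> b powr p - a powr p = (b - a) * l"
        using ab cont der by (intro MVT) (auto simp: real_differentiable_def)
      then show ?thesis using der DERIV_unique that by blast
    qed
    have "z powr (p - 1) \<le> T powr (p - 1)"
      using z ab assms(1) by (intro powr_mono2) auto
    then have "(b - a) * (p * z powr (p - 1)) \<le> (b - a) * (p * T powr (p - 1))"
      using ab assms(1) by (intro mult_left_mono) auto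
    with z show ?thesis by (simp add: mult_ac)
  qed
  have **: "a powr p \<le> b powr p" if "0 \<le> a" "a < b" for a b :: real
    using that assms(1) by (intro powr_mono2) auto
  consider "x < y" | "x = y" | "y < x" by linarith
  then show ?thesis
    by cases (use *[of x y] *[of y x] **[of x y] **[of y x] assms in auto)
qed

text \<open>A zero of the sine would force \<open>H\<close> to be an integer strictly between m - 1
  and m.\<close>

lemma fbm_const_pos:
  assumes "real m - 1 < H" "H < real m" "m \<ge> 1"
  shows "0 < fbm_const H"
proof -
  have "sin (pi * H) \<noteq> 0"
  proof
    assume "sin (pi * H) = 0"
    then obtain i :: int where "pi * H = of_int i * pi"
      by (auto simp: sin_zero_iff_int2)
    then have "H = of_int i" by simp
    with assms have "int m - 1 < i" "i < int m" by linarith+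
    then show False by simp
  qed
  moreover have "0 < Gamma (2 * H + 1)"
    using assms by (intro Gamma_real_pos) auto
  ultimately show ?thesis by (simp add: fbm_const_def)
qed

text \<open>On the diagonal every summand is a multiple of \<open>t powr (2 * H)\<close>, and the
  alternating partial sum of binomial coefficients collapses to a single one. With l = m - 1 the
  signs cancel, leaving
  \<open>fbm_const H * ((2 * H - 1) gchoose l) * t powr (2 * H)\<close>.\<close>

lemma fbm_cov_diagonal_pos:
  assumes "real m - 1 < H" "H < real m" "m \<ge> 2" "0 < t"
  shows "0 < fbm_cov H m t t"
proof -
  obtain l where l: "m = Suc l" using assms by (cases m) auto
  have "(\<Sum>j<m. (- 1) ^ j * ((2 * H) gchoose j) *
         (t ^ j * t powr (2 * H - real j) + t ^ j * t powr (2 * H - real j)))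
      = (\<Sum>j<m. ((2 * H) gchoose j) * (- 1) ^ j * (2 * t powr (2 * H)))"
    using assms(4) by (intro sum.cong) (auto simp: powr_diff powr_realpow)
  also have "\<dots> = (\<Sum>j\<le>l. ((2 * H) gchoose j) * (- 1) ^ j) * (2 * t powr (2 * H))"
    by (simp only: sum_distrib_right l lessThan_Suc_atMost)
  also have "\<dots> = (- 1) ^ l * ((2 * H - 1) gchoose l) * (2 * t powr (2 * H))"
    by (simp only: gbinomial_sum_lower_neg)
  finally have "fbm_cov H m t t =
      ((- 1) ^ l * (- 1) ^ l) * (fbm_const H * ((2 * H - 1) gchoose l) * t powr (2 * H))"
    using assms by (simp add: fbm_cov_def l)
  moreover have "(- 1 :: real) ^ l * (- 1) ^ l = 1"
    by (simp flip: power_mult_distrib)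
  \<comment> \<open>Each factor 2H - 1 - i with i < l is at least 2H - l, which exceeds l because H
    > l.\<close>
  moreover have "0 < (2 * H - 1) gchoose l"
    unfolding gbinomial_prod_rev
    using assms by (intro divide_pos_pos prod_pos) (auto simp: l)
  moreover have "0 < fbm_const H"
    using assms fbm_const_pos[of m H] by simp
  ultimately show ?thesis using assms by simp
qed

text \<open>The variance of B t - B s predicted by bilinearity, kept free of the process so that it
  can be estimated by calculus alone.\<close>

definition fbm_incr :: "real \<Rightarrow> nat \<Rightarrow> real \<Rightarrow> real \<Rightarrow> real" where
  "fbm_incr H m s t = fbm_cov H m t t + fbm_cov H m s s - 2 * fbm_cov H m s t"

text \<open>Only \<open>0 ^ 0 * t powr (2 * H)\<close> survives in the sum, and it cancels the
  leading term. Hence the increment from 0 to T has the variance of B T.\<close>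

lemma fbm_cov_0_left:
  assumes "real m - 1 < H" "m \<ge> 1" "0 \<le> t"
  shows "fbm_cov H m 0 t = 0"
proof -
  have "(\<Sum>j<m. (- 1) ^ j * ((2 * H) gchoose j) *
         (t ^ j * 0 powr (2 * H - real j) + 0 ^ j * t powr (2 * H - real j)))
      = (\<Sum>j<m. if j = 0 then t powr (2 * H) else 0)"
    by (intro sum.cong) auto
  also have "\<dots> = t powr (2 * H)"
    using assms by simp
  finally show ?thesis
    using assms by (simp add: fbm_cov_def)
qed

text \<open>The terms with \<open>j = 0\<close> vanish, and for \<open>0 < j < m\<close> both factors are Lipschitz
  because \<open>2 * H - j > 1\<close>.\<close>

lemma fbm_incr_eq:
  assumes "real m - 1 < H" "m \<ge> 2" "0 \<le> s" "0 \<le> t"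
  shows "fbm_incr H m s t = - ((- 1) ^ m * fbm_const H * (\<bar>t - s\<bar> powr (2 * H) +
    (\<Sum>j\<in>{1..<m}. (- 1) ^ j * ((2 * H) gchoose j) *
      ((t powr real j - s powr real j) *
       (t powr (2 * H - real j) - s powr (2 * H - real j)))))) "
proof -
  have pow: "x powr real j * x powr (2 * H - real j) = x powr (2 * H)" if "0 \<le> x" for x j
    using that by (auto simp: powr_add[symmetric])
  \<comment> \<open>The case j = 0 must be split off: \<open>0 ^ 0\<close> is 1, whereas
    \<open>0 powr 0\<close> is 0.\<close>
  have nat: "x ^ j = x powr real j" if "0 \<le> x" "0 < j" for x :: real and j
    using that by (simp add: powr_realpow')
  define c where "c j = (- 1) ^ j * ((2 * H) gchoose j)" for j
  define K where "K = (- 1) ^ m * fbm_const H"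
  define S where "S x y = (\<Sum>j<m. c j * (y ^ j * x powr (2 * H - real j) + x ^ j * y powr (2 * H - real j)))"
    for x y
  have cov: "fbm_cov H m x y = K / 2 * (\<bar>y - x\<bar> powr (2 * H) - S x y)" for x y
    unfolding fbm_cov_def K_def S_def c_def by simp
  have S: "S x y = c 0 * (x powr (2 * H) + y powr (2 * H)) + (\<Sum>j\<in>{1..<m}. c j *
      (y powr real j * x powr (2 * H - real j) + x powr real j * y powr (2 * H - real j)))"
    if "0 \<le> x" "0 \<le> y" for x y
  proof -
    have "{..<m} = insert 0 {1..<m}" using assms by auto
    then have "S x y = c 0 * (x powr (2 * H) + y powr (2 * H)) + (\<Sum>j\<in>{1..<m}. c j *
      (y ^ j * x powr (2 * H - real j) + x ^ j * y powr (2 * H - real j)))"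
      by (simp add: S_def)
    also have "(\<Sum>j\<in>{1..<m}. c j *
      (y ^ j * x powr (2 * H - real j) + x ^ j * y powr (2 * H - real j))) =
      (\<Sum>j\<in>{1..<m}. c j *
      (y powr real j * x powr (2 * H - real j) + x powr real j * y powr (2 * H - real j)))"
      using that by (intro sum.cong refl) (simp add: nat)
    finally show ?thesis .
  qed
  \<comment> \<open>With p = j and q = 2H - j this is the factorization t^p t^q + s^p s^q - t^p s^q
    - s^p t^q = (t^p - s^p) (t^q - s^q).\<close>
  have "S t t + S s s - 2 * S s t = 2 * (\<Sum>j\<in>{1..<m}. c j *
      ((t powr real j - s powr real j) * (t powr (2 * H - real j) - s powr (2 * H - real j))))"
    unfolding S[OF assms(4) assms(4)] S[OF assms(3) assms(3)] S[OF assms(3) assms(4)]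
      sum_distrib_left
    by (simp add: algebra_simps sum.distrib[symmetric] sum_subtractf[symmetric] sum_distrib_left)
  moreover have "fbm_incr H m s t =
      - (K * (\<bar>t - s\<bar> powr (2 * H) + (S t t + S s s - 2 * S s t) / 2))"
    by (simp add: fbm_incr_def cov field_simps)
  ultimately show ?thesis
    by (simp add: K_def c_def)
qed

text \<open>Every summand of \<open>fbm_incr_eq\<close> is quadratic in t - s: the products of
  differences by \<open>powr_lipschitz\<close> applied to both factors, the pure power because 2H >
  2.\<close>

lemma fbm_incr_le:
  assumes "real m - 1 < H" "m \<ge> 2"
  obtains K where "0 \<le> K"
    "\<And>s t. 0 \<le> s \<Longrightarrow> s \<le> T \<Longrightarrow> 0 \<le> t \<Longrightarrow> t \<le> T \<Longrightarrow> fbm_incr H m s t \<le> K * (t - s)\<^sup>2"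
proof -
  \<comment> \<open>\<open>L p\<close> is the Lipschitz constant of x powr p on [0, T].\<close>
  define L where "L p = p * T powr (p - 1)" for p
  define c where "c j = (- 1) ^ j * ((2 * H) gchoose j)" for j
  define K where "K = \<bar>fbm_const H\<bar> *
     (T powr (2 * H - 2) + (\<Sum>j\<in>{1..<m}. \<bar>c j\<bar> * (L (real j) * L (2 * H - real j))))"
  show ?thesis
  proof
    show "0 \<le> K"
      unfolding K_def L_def using assms
      by (intro mult_nonneg_nonneg add_nonneg_nonneg sum_nonneg) auto
    fix s t assume st: "0 \<le> s" "s \<le> T" "0 \<le> t" "t \<le> T"
    \<comment> \<open>A square is kept, and the remaining positive power 2H - 2 is bounded using |t
      - s| \<le> T.\<close>
    have *: "\<bar>t - s\<bar> powr (2 * H) \<le> T powr (2 * H - 2) * (t - s)\<^sup>2"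
    proof -
      have "\<bar>t - s\<bar> powr (2 * H) = \<bar>t - s\<bar> powr (2 * H - 2) * \<bar>t - s\<bar> powr 2"
        using powr_add[of "\<bar>t - s\<bar>" "2 * H - 2" 2] by simp
      also have "\<dots> \<le> T powr (2 * H - 2) * \<bar>t - s\<bar> powr 2"
        using st assms by (intro mult_right_mono powr_mono2) auto
      finally show ?thesis by (simp add: powr_numeral)
    qed
    have **: "\<bar>c j * ((t powr real j - s powr real j) *
         (t powr (2 * H - real j) - s powr (2 * H - real j)))\<bar>
        \<le> \<bar>c j\<bar> * (L (real j) * L (2 * H - real j)) * (t - s)\<^sup>2" if "j \<in> {1..<m}" for j
    proof -
      have "\<bar>t powr real j - s powr real j\<bar> \<le> L (real j) * \<bar>t - s\<bar>"
        unfolding L_def using that st by (intro powr_lipschitz) auto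
      moreover have "\<bar>t powr (2 * H - real j) - s powr (2 * H - real j)\<bar>
          \<le> L (2 * H - real j) * \<bar>t - s\<bar>"
        unfolding L_def using that st assms by (intro powr_lipschitz) auto
      ultimately have "\<bar>t powr real j - s powr real j\<bar> * \<bar>t powr (2 * H - real j) - s powr (2 * H - real j)\<bar>
         \<le> (L (real j) * \<bar>t - s\<bar>) * (L (2 * H - real j) * \<bar>t - s\<bar>)"
        by (intro mult_mono) auto
      also have "\<dots> = L (real j) * L (2 * H - real j) * (t - s)\<^sup>2"
        by (simp add: power2_eq_square)
      finally show ?thesis
        by (simp add: abs_mult mult.assoc mult_left_mono)
    qed
    have "fbm_incr H m s t \<le> \<bar>fbm_incr H m s t\<bar>" by simp
    also have "\<dots> = \<bar>fbm_const H\<bar> * \<bar>\<bar>t - s\<bar> powr (2 * H) + (\<Sum>j\<in>{1..<m}. c j *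
      ((t powr real j - s powr real j) * (t powr (2 * H - real j) - s powr (2 * H - real j))))\<bar>"
      unfolding fbm_incr_eq[OF assms st(1,3)] c_def by (simp add: abs_mult)
    also have "\<dots> \<le> \<bar>fbm_const H\<bar> * (T powr (2 * H - 2) * (t - s)\<^sup>2 +
       (\<Sum>j\<in>{1..<m}. \<bar>c j\<bar> * (L (real j) * L (2 * H - real j)) * (t - s)\<^sup>2))"
      using * by (intro mult_left_mono order.trans[OF abs_triangle_ineq] add_mono
          order.trans[OF sum_abs] sum_mono **) auto
    also have "\<dots> = K * (t - s)\<^sup>2"
      by (simp add: K_def algebra_simps sum_distrib_left sum_distrib_right)
    finally show "fbm_incr H m s t \<le> K * (t - s)\<^sup>2" .
  qed
qed

section \<open>Increments of the process\<close>

text \<open>Since the process is centered, covariances are mixed second moments, and expanding the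
  square links the probabilistic side to \<open>fbm_incr\<close>.\<close>

lemma higher_order_fbm_increment:
  assumes "prob_space M" "higher_order_fbm M H m B" "0 \<le> s" "0 \<le> t"
  shows "gaussian_rv M (\<lambda>\<omega>. B t \<omega> - B s \<omega>)"
    and "integrable M (\<lambda>\<omega>. (B t \<omega> - B s \<omega>)\<^sup>2)"
    and "(\<integral>\<omega>. (B t \<omega> - B s \<omega>)\<^sup>2 \<partial>M) = fbm_incr H m s t"
proof -
  have lin: "gaussian_rv M (\<lambda>\<omega>. \<Sum>t\<in>J. c t * B t \<omega>)" if "finite J" "J \<subseteq> {0..}" for J c
    using assms(2) that by (auto simp: higher_order_fbm_def gaussian_process_def)
  have cov: "(\<integral>\<omega>. B x \<omega> * B y \<omega> \<partial>M) = fbm_cov H m x y" if "0 \<le> x" "0 \<le> y" for x y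
    using assms(2) that by (auto simp: higher_order_fbm_def covariance_def)
  have sq: "integrable M (\<lambda>\<omega>. (B x \<omega>)\<^sup>2)" if "0 \<le> x" for x
    using gaussian_rv_square_integrable[OF assms(1) lin[of "{x}" "\<lambda>_. 1"]] that by simp
  show G: "gaussian_rv M (\<lambda>\<omega>. B t \<omega> - B s \<omega>)"
  \<comment> \<open>Linear combinations are indexed by sets: for s = t the set {s, t} is a singleton
    and the two coefficients could not cancel.\<close>
  proof (cases "s = t")
    case True
    then show ?thesis using lin[of "{}" "\<lambda>_. 0"] by simp
  next
    case False
    then show ?thesis
      using lin[of "{s, t}" "\<lambda>x. if x = t then 1 else - 1"] assms(3,4) by simp
  qed
  show I: "integrable M (\<lambda>\<omega>. (B t \<omega> - B s \<omega>)\<^sup>2)"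
    by (rule gaussian_rv_square_integrable[OF assms(1) G])
  \<comment> \<open>Polarization: the product B s * B t inherits integrability from three
    squares.\<close>
  have "integrable M (\<lambda>\<omega>. ((B t \<omega>)\<^sup>2 + (B s \<omega>)\<^sup>2 - (B t \<omega> - B s \<omega>)\<^sup>2) / 2)"
    using sq[OF assms(3)] sq[OF assms(4)] I
    by (intro integrable_divide Bochner_Integration.integrable_diff
        Bochner_Integration.integrable_add)
  also have "(\<lambda>\<omega>. ((B t \<omega>)\<^sup>2 + (B s \<omega>)\<^sup>2 - (B t \<omega> - B s \<omega>)\<^sup>2) / 2) = (\<lambda>\<omega>. B s \<omega> * B t \<omega>)"
    by (auto simp: power2_eq_square algebra_simps)
  finally have P: "integrable M (\<lambda>\<omega>. B s \<omega> * B t \<omega>)" .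
  have "(\<integral>\<omega>. (B t \<omega> - B s \<omega>)\<^sup>2 \<partial>M)
      = (\<integral>\<omega>. (B t \<omega>)\<^sup>2 + (B s \<omega>)\<^sup>2 - 2 * (B s \<omega> * B t \<omega>) \<partial>M)"
    by (simp add: power2_eq_square algebra_simps)
  also have "\<dots> = (\<integral>\<omega>. (B t \<omega>)\<^sup>2 \<partial>M) + (\<integral>\<omega>. (B s \<omega>)\<^sup>2 \<partial>M) - 2 * (\<integral>\<omega>. B s \<omega> * B t \<omega> \<partial>M)"
    using sq[OF assms(3)] sq[OF assms(4)] P by simp
  also have "\<dots> = fbm_incr H m s t"
    using cov assms(3,4) by (simp add: fbm_incr_def power2_eq_square)
  finally show "(\<integral>\<omega>. (B t \<omega> - B s \<omega>)\<^sup>2 \<partial>M) = fbm_incr H m s t" .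
qed

section \<open>Pathwise bounds for the weighted quadratic variation\<close>

lemma weighted_qv_nonneg: "0 \<le> weighted_qv \<alpha> T x n"
  by (simp add: weighted_qv_def sum_nonneg)

lemma weighted_qv_mono: "\<alpha> \<le> \<beta> \<Longrightarrow> weighted_qv \<alpha> T x n \<le> weighted_qv \<beta> T x n"
  by (auto simp: weighted_qv_def intro!: mult_right_mono sum_nonneg powr_mono)

text \<open>The increments telescope to x T - x 0. Cauchy-Schwarz over 2^n terms costs a factor 2^n,
  which turns \<alpha> into \<alpha> - 1.\<close>

lemma weighted_qv_ge:
  "2 powr ((\<alpha> - 1) * real n) * (x T - x 0)\<^sup>2 \<le> weighted_qv \<alpha> T x n"
proof -
  define d where "d k = x (real k * T / 2 ^ n) - x ((real k - 1) * T / 2 ^ n)" for k :: nat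
  have "(\<Sum>k = 1..2 ^ n. d k) = (\<Sum>k<2 ^ n. x (real (Suc k) * T / 2 ^ n) - x (real k * T / 2 ^ n))"
    by (rule sum.reindex_bij_witness[of _ Suc "\<lambda>k. k - 1"]) (auto simp: d_def)
  also have "\<dots> = x T - x 0"
    by (subst sum_lessThan_telescope) simp
  finally have "(x T - x 0)\<^sup>2 \<le> 2 ^ n * (\<Sum>k = 1..2 ^ n. (d k)\<^sup>2)"
    using Cauchy_Schwarz_ineq_sum[of "\<lambda>_. 1" d "{1..2 ^ n}"] by simp
  then have "2 powr ((\<alpha> - 1) * real n) * (x T - x 0)\<^sup>2
      \<le> 2 powr ((\<alpha> - 1) * real n) * (2 ^ n * (\<Sum>k = 1..2 ^ n. (d k)\<^sup>2))"
    by (intro mult_left_mono) auto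
  also have "\<dots> = (2 powr ((\<alpha> - 1) * real n) * 2 powr real n) * (\<Sum>k = 1..2 ^ n. (d k)\<^sup>2)"
    by (simp add: powr_realpow)
  also have "2 powr ((\<alpha> - 1) * real n) * 2 powr real n = 2 powr (\<alpha> * real n)"
    by (simp add: algebra_simps flip: powr_add)
  finally show ?thesis by (simp add: weighted_qv_def d_def)
qed

lemma weighted_qv_at_top:
  assumes "1 < \<alpha>" "x T \<noteq> x 0"
  shows "filterlim (weighted_qv \<alpha> T x) at_top sequentially"
proof (rule filterlim_at_top_mono)
  have "filterlim (\<lambda>n. (\<alpha> - 1) * ln 2 * real n) at_top sequentially"
    using assms(1)
    by (intro filterlim_tendsto_pos_mult_at_top[OF tendsto_const] filterlim_real_sequentially) simp
  then have "filterlim (\<lambda>n. exp ((\<alpha> - 1) * ln 2 * real n)) at_top sequentially"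
    by (rule filterlim_compose[OF exp_at_top])
  then have "filterlim (\<lambda>n. (x T - x 0)\<^sup>2 * exp ((\<alpha> - 1) * ln 2 * real n)) at_top sequentially"
    using assms(2) by (intro filterlim_tendsto_pos_mult_at_top[OF tendsto_const]) auto
  then show "filterlim (\<lambda>n. 2 powr ((\<alpha> - 1) * real n) * (x T - x 0)\<^sup>2) at_top sequentially"
    by (simp add: powr_def mult_ac)
  show "\<forall>\<^sub>F n in sequentially. 2 powr ((\<alpha> - 1) * real n) * (x T - x 0)\<^sup>2 \<le> weighted_qv \<alpha> T x n"
    by (simp add: weighted_qv_ge)
qed

section \<open>Almost sure limits and the critical exponent\<close>

context
  fixes M :: "'a measure" and B :: "real \<Rightarrow> 'a \<Rightarrow> real" and m :: nat and H T :: real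
  assumes M: "prob_space M" and m: "m \<ge> 2" and H: "real m - 1 < H" "H < real m"
    and T: "T > 0" and B: "higher_order_fbm M H m B"
begin

lemma weighted_qv_fbm_tendsto_0:
  assumes "\<alpha> < 1"
  shows "AE \<omega> in M. weighted_qv \<alpha> T (\<lambda>t. B t \<omega>) \<longlonglongrightarrow> 0"
proof -
  obtain K where K: "0 \<le> K"
    "\<And>s t. 0 \<le> s \<Longrightarrow> s \<le> T \<Longrightarrow> 0 \<le> t \<Longrightarrow> t \<le> T \<Longrightarrow> fbm_incr H m s t \<le> K * (t - s)\<^sup>2"
    using fbm_incr_le[OF H(1) m] by blast
  \<comment> \<open>\<open>r n k\<close> and \<open>l n k\<close> are the right and left endpoints
    of the k-th dyadic interval.\<close>
  define r where "r n k = real k * T / 2 ^ n" for n k :: nat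
  define l where "l n k = (real k - 1) * T / 2 ^ n" for n k :: nat
  have rl: "0 \<le> r n k" "r n k \<le> T" "0 \<le> l n k" "l n k \<le> T" "r n k - l n k = T / 2 ^ n"
    if "k \<in> {1..2 ^ n}" for n k
  proof -
    have "real k \<le> real (2 ^ n)"
      using that by (intro of_nat_mono) simp
    then have k: "1 \<le> real k" "real k \<le> 2 ^ n" using that by simp_all
    then have "real k * T \<le> 2 ^ n * T" "(real k - 1) * T \<le> 2 ^ n * T"
      using T by (intro mult_right_mono; linarith)+
    then show "r n k \<le> T" "l n k \<le> T"
      unfolding r_def l_def
      by (simp_all only: pos_divide_le_eq zero_less_power zero_less_numeral mult.commute)
    show "0 \<le> r n k" "0 \<le> l n k"
      using k T by (simp_all add: r_def l_def)
    show "r n k - l n k = T / 2 ^ n"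
      unfolding r_def l_def diff_divide_distrib[symmetric] left_diff_distrib by simp
  qed
  have qv: "weighted_qv \<alpha> T (\<lambda>t. B t \<omega>) n =
      2 powr (\<alpha> * real n) * (\<Sum>k = 1..2 ^ n. (B (r n k) \<omega> - B (l n k) \<omega>)\<^sup>2)" for \<omega> n
    by (simp add: weighted_qv_def r_def l_def)
  have int: "integrable M (\<lambda>\<omega>. weighted_qv \<alpha> T (\<lambda>t. B t \<omega>) n)" for n
    unfolding qv using rl
    by (intro integrable_mult_right Bochner_Integration.integrable_sum
        higher_order_fbm_increment[OF M B]) auto
  \<comment> \<open>There are 2^n increments, each of second moment at most K (T / 2^n)^2. The ratio
    of the resulting geometric bound is below 1 because \<alpha> < 1.\<close>
  have le: "(\<integral>\<omega>. weighted_qv \<alpha> T (\<lambda>t. B t \<omega>) n \<partial>M) \<le> K * T\<^sup>2 * (2 powr (\<alpha> - 1)) ^ n" for n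
  proof -
    have "(\<integral>\<omega>. weighted_qv \<alpha> T (\<lambda>t. B t \<omega>) n \<partial>M) =
        2 powr (\<alpha> * real n) * (\<Sum>k = 1..2 ^ n. fbm_incr H m (l n k) (r n k))"
      unfolding qv using rl
      by (simp add: higher_order_fbm_increment[OF M B] Bochner_Integration.integral_sum)
    also have "\<dots> \<le> 2 powr (\<alpha> * real n) * (\<Sum>k = 1..2 ^ n :: nat. K * (T / 2 ^ n)\<^sup>2)"
    proof (intro mult_left_mono sum_mono)
      fix k :: nat assume k: "k \<in> {1..2 ^ n}"
      show "fbm_incr H m (l n k) (r n k) \<le> K * (T / 2 ^ n)\<^sup>2"
        using K(2)[OF rl(3,4,1,2)[OF k]] rl(5)[OF k] by simp
    qed simp
    also have "\<dots> = K * T\<^sup>2 * (2 powr (\<alpha> * real n) / 2 ^ n)"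
      by (simp add: field_simps power2_eq_square)
    also have "2 powr (\<alpha> * real n) / 2 ^ n = (2 powr (\<alpha> - 1)) ^ n"
      by (simp add: powr_diff power_divide powr_powr[symmetric] powr_realpow)
    finally show ?thesis .
  qed
  have "summable (\<lambda>n. \<integral>\<omega>. weighted_qv \<alpha> T (\<lambda>t. B t \<omega>) n \<partial>M)"
  proof (rule summable_comparison_test')
    have "2 powr (\<alpha> - 1) < 2 powr 0"
      using assms by (intro powr_less_mono) auto
    then show "summable (\<lambda>n. K * T\<^sup>2 * (2 powr (\<alpha> - 1)) ^ n)"
      by (intro summable_mult summable_geometric) simp
    show "norm (\<integral>\<omega>. weighted_qv \<alpha> T (\<lambda>t. B t \<omega>) n \<partial>M) \<le> K * T\<^sup>2 * (2 powr (\<alpha> - 1)) ^ n"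
      if "n \<ge> 0" for n
      using le[of n] by (simp add: integral_nonneg weighted_qv_nonneg)
  qed
  from AE_tendsto_0_if_summable_expectation[OF int _ this] show ?thesis
    by (simp add: weighted_qv_nonneg)
qed

text \<open>The only exceptional event is B T = B 0, which does not involve \<alpha>; hence one null
  set serves all \<alpha> > 1.\<close>

lemma weighted_qv_fbm_at_top:
  "AE \<omega> in M. \<forall>\<alpha>>1. filterlim (weighted_qv \<alpha> T (\<lambda>t. B t \<omega>)) at_top sequentially"
proof -
  have "fbm_incr H m 0 T = fbm_cov H m T T"
    using m T H(1) by (simp add: fbm_incr_def fbm_cov_0_left)
  then have "fbm_incr H m 0 T \<noteq> 0"
    using fbm_cov_diagonal_pos[OF H m T] by simp
  then have "AE \<omega> in M. B T \<omega> - B 0 \<omega> \<noteq> 0"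
    using T higher_order_fbm_increment[OF M B, of 0 T] by (intro gaussian_rv_AE_nonzero[OF M]) auto
  then show ?thesis
    by eventually_elim (auto intro: weighted_qv_at_top)
qed

end

text \<open>\<open>critical_exponent\<close> asks for one null set for all \<alpha>, while
  convergence to 0 is known for each \<alpha> separately. Monotonicity in \<alpha> reduces it to the
  countably many exponents 1 - 1 / (i + 1), which approach 1.\<close>

lemma higher_order_fbm_critical_exponent:
  assumes "prob_space M" "m \<ge> 2" "real m - 1 < H" "H < real m" "higher_order_fbm M H m B"
  shows "critical_exponent M B 1"
proof -
  have "AE \<omega> in M. \<forall>i::nat. weighted_qv (1 - inverse (real (Suc i))) 1 (\<lambda>t. B t \<omega>) \<longlonglongrightarrow> 0"
    unfolding AE_all_countable
    using weighted_qv_fbm_tendsto_0[OF assms(1-4) zero_less_one assms(5)] by simp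
  moreover have "AE \<omega> in M. \<forall>\<alpha>>1. filterlim (weighted_qv \<alpha> 1 (\<lambda>t. B t \<omega>)) at_top sequentially"
    by (rule weighted_qv_fbm_at_top[OF assms(1-4) zero_less_one assms(5)])
  ultimately show ?thesis
    unfolding critical_exponent_def
  proof eventually_elim
    case (elim \<omega>)
    have "weighted_qv \<alpha> 1 (\<lambda>t. B t \<omega>) \<longlonglongrightarrow> 0" if "\<alpha> < 1" for \<alpha>
    proof -
      have "0 < 1 - \<alpha>" using that by simp
      from reals_Archimedean[OF this] obtain i where "inverse (real (Suc i)) < 1 - \<alpha>" ..
      then have "\<alpha> \<le> 1 - inverse (real (Suc i))" by linarith
      then have "weighted_qv \<alpha> 1 (\<lambda>t. B t \<omega>) n
          \<le> weighted_qv (1 - inverse (real (Suc i))) 1 (\<lambda>t. B t \<omega>) n" for n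
        by (rule weighted_qv_mono)
      \<comment> \<open>The variation is squeezed between 0 and the one with the larger exponent,
        which tends to 0.\<close>
      then show ?thesis
        by (intro tendsto_sandwich[OF _ _ tendsto_const elim(1)[rule_format, of i]]
            always_eventually allI weighted_qv_nonneg)
    qed
    with elim(2) show ?case by blast
  qed
qed

theorem theorem2p2:
  fixes M :: "'a measure" and B :: "real \<Rightarrow> 'a \<Rightarrow> real" and m :: nat and H T :: real
  assumes "prob_space M"
    and "m \<ge> 2"
    and "real m - 1 < H" and "H < real m"
    and "T > 0"
    and "higher_order_fbm M H m B"
  shows "(\<forall>\<alpha><1. AE \<omega> in M. weighted_qv \<alpha> T (\<lambda>t. B t \<omega>) \<longlonglongrightarrow> 0) \<and>
    (m \<ge> 3 \<longrightarrow>
      (\<forall>\<alpha>>1. AE \<omega> in M. filterlim (weighted_qv \<alpha> T (\<lambda>t. B t \<omega>)) at_top sequentially)) \<and>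
    (m \<ge> 3 \<longrightarrow> critical_exponent M B 1)"
proof (intro conjI impI allI)
  show "AE \<omega> in M. weighted_qv \<alpha> T (\<lambda>t. B t \<omega>) \<longlonglongrightarrow> 0" if "\<alpha> < 1" for \<alpha>
    by (rule weighted_qv_fbm_tendsto_0[OF assms that])
  show "AE \<omega> in M. filterlim (weighted_qv \<alpha> T (\<lambda>t. B t \<omega>)) at_top sequentially" if "\<alpha> > 1" for \<alpha>
    using weighted_qv_fbm_at_top[OF assms] by eventually_elim (use that in blast)
  show "critical_exponent M B 1"
    by (rule higher_order_fbm_critical_exponent[OF assms(1-4,6)])
qed

end
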